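(* Let $0<\alpha<1$ and let $(\epsilon_i)_{i\ge 1}$ be a nonincreasing sequence of positive real numbers with $\epsilon_1\le 1-\alpha$ and $\sum_{i=1}^{+\infty}2^{i-1}\epsilon_i<\alpha$. Let $\psi:[0,1)\to\mathbb{R}$ be the pointwise limit $\psi(x)=\lim_{i\to\infty}\psi_i(x)$ of the sequence of functions $\psi_i$ constructed from $\alpha,\epsilon_1,\epsilon_2,\ldots$ as described in the context. Then $\psi$ is continuous.
   Context: Construction of $\psi_i$: let $0<\alpha<1$ and let $(\epsilon_i)_{i\ge1}$ be a nonincreasing sequence of positive reals with $\epsilon_1\le 1-\alpha$ and $\sum_{i\ge1}2^{i-1}\epsilon_i<\alpha$. Define $\psi_0(x)=x/\alpha$ for $0\le x\le\alpha$ and $\psi_0(x)=(1-x)/(1-\alpha)$ for $\alpha\le x<1$. Given $\psi_i$, the function $\psi_{i+1}:[0,1)\to\mathbb{R}$ is obtained by modifying $\psi_i$ as follows: for every maximal (with respect to inclusion) interval $[a,b]\subseteq[0,\alpha]$ on which $\psi_i$ has constant positive slope, the line segment of the graph from $(a,\psi_i(a))$ to $(b,\psi_i(b))$ is replaced by the three segments successively connecting the points $(a,\psi_i(a))$, $\left(\frac{a+b-\epsilon_{i+1}}{2},\psi_i(\frac{a+b}{2})+\frac{\epsilon_{i+1}}{2(1-\alpha)}\right)$, $\left(\frac{a+b+\epsilon_{i+1}}{2},\psi_i(\frac{a+b}{2})-\frac{\epsilon_{i+1}}{2(1-\alpha)}\right)$, $(b,\psi_i(b))$; elsewhere $\psi_{i+1}=\psi_i$.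 The pointwise limit $\psi(x)=\lim_{i\to\infty}\psi_i(x)$ exists for every $x\in[0,1)$. *)

theory Defs
  imports "HOL-Analysis.Analysis"
begin

text \<open>
  Functions on \<open>[0,1)\<close> are total functions on the reals; their values outside \<open>[0,1)\<close> never matter.
\<close>

definition const_pos_slope :: "(real \<Rightarrow> real) \<Rightarrow> real \<Rightarrow> real \<Rightarrow> bool" where
  "const_pos_slope f a b \<longleftrightarrow>
     a < b \<and> (\<exists>s>0. \<forall>x\<in>{a..b}. \<forall>y\<in>{a..b}. f y - f x = s * (y - x))"

definition max_pos_slope :: "real \<Rightarrow> (real \<Rightarrow> real) \<Rightarrow> real \<Rightarrow> real \<Rightarrow> bool" where
  "max_pos_slope \<alpha> f a b \<longleftrightarrow>
     {a..b} \<subseteq> {0..\<alpha>} \<and> const_pos_slope f a b \<and>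
     (\<forall>c d. {c..d} \<subseteq> {0..\<alpha>} \<and> const_pos_slope f c d \<and> {a..b} \<subseteq> {c..d} \<longrightarrow> {c..d} = {a..b})"

definition line_through :: "real \<times> real \<Rightarrow> real \<times> real \<Rightarrow> real \<Rightarrow> real" where
  "line_through P Q x = snd P + (snd Q - snd P) / (fst Q - fst P) * (x - fst P)"

definition zigzag :: "real \<Rightarrow> real \<Rightarrow> (real \<Rightarrow> real) \<Rightarrow> real \<Rightarrow> real \<Rightarrow> real \<Rightarrow> real" where
  "zigzag \<alpha> e f a b x =
     (let A = (a, f a);
          P = ((a + b - e) / 2, f ((a + b) / 2) + e / (2 * (1 - \<alpha>)));
          Q = ((a + b + e) / 2, f ((a + b) / 2) - e / (2 * (1 - \<alpha>)));
          B = (b, f b)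
      in if x \<le> fst P then line_through A P x
         else if x \<le> fst Q then line_through P Q x
         else line_through Q B x)"

lemma max_pos_slope_unique:
  assumes "max_pos_slope \<alpha> f a b" "max_pos_slope \<alpha> f c d"
    and "a < x" "x < b" "c < x" "x < d"
  shows "a = c \<and> b = d"
proof -
  define l u where "l = max a c" and "u = min b d"
  have lu: "l < x" "x < u" using assms(3-6) by (auto simp: l_def u_def)
  obtain s where s: "s > 0" "\<And>x y. x \<in> {a..b} \<Longrightarrow> y \<in> {a..b} \<Longrightarrow> f y - f x = s * (y - x)"
    using assms(1) unfolding max_pos_slope_def const_pos_slope_def by blast
  obtain t where t: "t > 0" "\<And>x y. x \<in> {c..d} \<Longrightarrow> y \<in> {c..d} \<Longrightarrow> f y - f x = t * (y - x)"
    using assms(2) unfolding max_pos_slope_def const_pos_slope_def by blast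
  have "s * (u - l) = t * (u - l)"
    using s(2)[of l u] t(2)[of l u] lu by (auto simp: l_def u_def)
  hence st: "t = s" using lu by simp
  have to_x: "f y - f x = s * (y - x)" if "y \<in> {min a c..max b d}" for y
  proof (cases "y \<in> {a..b}")
    case True
    thus ?thesis using s(2)[of x y] assms by auto
  next
    case False
    hence "y \<in> {c..d}" using that assms(3-6) by auto
    thus ?thesis using t(2)[of x y] st assms by auto
  qed
  have "const_pos_slope f (min a c) (max b d)"
    unfolding const_pos_slope_def
  proof (intro conjI exI[of _ s] ballI)
    fix y z assume "y \<in> {min a c..max b d}" "z \<in> {min a c..max b d}"
    from to_x[OF this(1)] to_x[OF this(2)] show "f z - f y = s * (z - y)"
      by (simp add: algebra_simps)
  qed (use s assms(3-6) in auto)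
  moreover have "{min a c..max b d} \<subseteq> {0..\<alpha>}"
    using assms(1,2) assms(3-6) unfolding max_pos_slope_def by auto
  ultimately have "{min a c..max b d} = {a..b}" "{min a c..max b d} = {c..d}"
    using assms(1,2) unfolding max_pos_slope_def by auto
  thus ?thesis using assms(3-6) by (auto simp: Icc_eq_Icc)
qed

text \<open>
  Testing \<open>x\<close> against the open interval makes the maximal interval unique (lemma \<open>max_pos_slope_unique\<close>).
  Nothing is lost, as the replacement leaves the values at \<open>a\<close> and \<open>b\<close> unchanged
  (lemma \<open>zigzag_ends\<close>).
\<close>

definition psi_step :: "real \<Rightarrow> real \<Rightarrow> (real \<Rightarrow> real) \<Rightarrow> real \<Rightarrow> real" where
  "psi_step \<alpha> e f x =
     (if \<exists>a b. max_pos_slope \<alpha> f a b \<and> a < x \<and> x < b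
      then (let (a, b) = (THE (a, b). max_pos_slope \<alpha> f a b \<and> a < x \<and> x < b)
            in zigzag \<alpha> e f a b x)
      else f x)"

lemma psi_step_inside:
  assumes "max_pos_slope \<alpha> f a b" "a < x" "x < b"
  shows "psi_step \<alpha> e f x = zigzag \<alpha> e f a b x"
proof -
  have "(THE (a, b). max_pos_slope \<alpha> f a b \<and> a < x \<and> x < b) = (a, b)"
  proof (rule the_equality)
    fix z assume "case z of (a, b) \<Rightarrow> max_pos_slope \<alpha> f a b \<and> a < x \<and> x < b"
    thus "z = (a, b)"
      using max_pos_slope_unique[OF _ assms(1) _ _ assms(2,3)] by (cases z) auto
  qed (use assms in auto)
  thus ?thesis using assms by (auto simp: psi_step_def)
qed

lemma zigzag_ends:
  assumes "0 < e" "e < b - a"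
  shows "zigzag \<alpha> e f a b a = f a" "zigzag \<alpha> e f a b b = f b"
  using assms by (auto simp: zigzag_def line_through_def Let_def)

primrec psi_seq :: "real \<Rightarrow> (nat \<Rightarrow> real) \<Rightarrow> nat \<Rightarrow> real \<Rightarrow> real" where
  "psi_seq \<alpha> \<epsilon> 0 = (\<lambda>x. if x \<le> \<alpha> then x / \<alpha> else (1 - x) / (1 - \<alpha>))"
| "psi_seq \<alpha> \<epsilon> (Suc i) = psi_step \<alpha> (\<epsilon> (Suc i)) (psi_seq \<alpha> \<epsilon> i)"

definition psi :: "real \<Rightarrow> (nat \<Rightarrow> real) \<Rightarrow> real \<Rightarrow> real" where
  "psi \<alpha> \<epsilon> x = lim (\<lambda>i. psi_seq \<alpha> \<epsilon> i x)"

end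

theory Submission imports Defs begin

text \<open>
  Every \<open>\<psi>\<^sub>i\<close> is Lipschitz, and all its maximal intervals of constant positive slope have the same
  length and the same rise \<open>h\<^sub>i\<close>, where \<open>h\<^sub>i\<^sub>+\<^sub>1 = h\<^sub>i / 2 + \<epsilon>\<^sub>i\<^sub>+\<^sub>1 / (2 (1 - \<alpha>))\<close>. The
  modification moves each value by at most \<open>2 h\<^sub>i\<^sub>+\<^sub>1\<close>, and
  \<open>2\<^sup>i h\<^sub>i = 1 + (\<Sum>j\<le>i. 2\<^sup>j\<^sup>-\<^sup>1 \<epsilon>\<^sub>j) / (1 - \<alpha>) \<le> 1 / (1 - \<alpha>)\<close>, so the convergence is uniform by the
  Weierstrass M-test.
\<close>

section \<open>Maximal intervals and line segments\<close>

lemma max_pos_slope_less: "max_pos_slope \<alpha> f a b \<Longrightarrow> a < b"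
  by (simp add: max_pos_slope_def const_pos_slope_def)

lemma max_pos_slope_bounds: "max_pos_slope \<alpha> f a b \<Longrightarrow> 0 \<le> a \<and> b \<le> \<alpha>"
  using max_pos_slope_less[of \<alpha> f a b] by (auto simp: max_pos_slope_def)

text \<open>If the interiors overlapped, the midpoint of the overlap would be interior to both
  intervals, and a maximal interval is determined by any of its interior points.\<close>

lemma max_pos_slope_disjoint:
  assumes "max_pos_slope \<alpha> f a b" "max_pos_slope \<alpha> f c d"
  shows "(a = c \<and> b = d) \<or> b \<le> c \<or> d \<le> a"
proof (rule ccontr)
  assume neg: "\<not> ?thesis"
  define x where "x = (max a c + min b d) / 2"
  have "max a c < min b d"
    using neg max_pos_slope_less[OF assms(1)] max_pos_slope_less[OF assms(2)] by auto
  then have "a < x" "x < b" "c < x" "x < d" by (auto simp: x_def)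
  then show False using max_pos_slope_unique[OF assms] neg by blast
qed

lemma const_pos_slope_incseq:
  "const_pos_slope f a b \<Longrightarrow> a \<le> x \<Longrightarrow> x < y \<Longrightarrow> y \<le> b \<Longrightarrow> f x < f y"
proof -
  assume *: "const_pos_slope f a b" "a \<le> x" "x < y" "y \<le> b"
  then obtain s where "s > 0" "f y - f x = s * (y - x)"
    unfolding const_pos_slope_def by fastforce
  moreover have "s * (y - x) > 0" using \<open>s > 0\<close> *(3) by simp
  ultimately show ?thesis by linarith
qed

text \<open>Each value on a segment is a convex combination of the two end values, so a bound on the
  distance to \<open>m\<close> passes from the ends to the whole segment.\<close>

lemma line_through_dist_le:
  assumes "fst P < fst Q" "fst P \<le> x" "x \<le> fst Q" "\<bar>snd P - m\<bar> \<le> B" "\<bar>snd Q - m\<bar> \<le> B"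
  shows "\<bar>line_through P Q x - m\<bar> \<le> B"
proof -
  define t where "t = (x - fst P) / (fst Q - fst P)"
  have t: "0 \<le> t" "t \<le> 1" using assms by (auto simp: t_def)
  have "line_through P Q x = snd P + t * (snd Q - snd P)"
    by (simp add: line_through_def t_def)
  then have "line_through P Q x - m = (1 - t) * (snd P - m) + t * (snd Q - m)"
    by (simp add: algebra_simps)
  also have "\<bar>\<dots>\<bar> \<le> (1 - t) * \<bar>snd P - m\<bar> + t * \<bar>snd Q - m\<bar>"
    using t by (intro order_trans[OF abs_triangle_ineq]) (simp add: abs_mult)
  also have "\<dots> \<le> (1 - t) * B + t * B"
    using t assms by (intro add_mono mult_left_mono) auto
  finally show ?thesis by (simp add: algebra_simps)
qed

lemma line_through_lipschitz:
  "\<bar>(snd Q - snd P) / (fst Q - fst P)\<bar>-lipschitz_on S (line_through P Q)"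
  by (rule lipschitz_onI)
    (simp_all del: times_divide_eq_left times_divide_eq_right abs_divide
      add: line_through_def dist_real_def right_diff_distrib[symmetric] abs_mult[symmetric])

section \<open>The invariant of the construction\<close>

text \<open>Properties that one modification step reproduces with new \<open>L\<close> and
  \<open>h\<close>. Through \<open>right_germ\<close> an interval of constant positive slope can be
  located from its left end: the alternative of a strict decrease just to the right is impossible
  there. \<open>lipschitz\<close> leaves the constant open, since it serves to give continuity of
  each function separately.\<close>

locale sawtooth =
  fixes \<alpha> :: real and f :: "real \<Rightarrow> real" and L h :: real
  assumes alpha: "0 < \<alpha>" "\<alpha> < 1"
    and L_pos: "0 < L" and h_pos: "0 < h"
    and length_rise: "max_pos_slope \<alpha> f a b \<Longrightarrow> b - a = L \<and> f b - f a = h"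
    and right_germ: "0 \<le> x \<Longrightarrow> x < \<alpha> \<Longrightarrow>
      (\<exists>a b. max_pos_slope \<alpha> f a b \<and> a \<le> x \<and> x < b) \<or>
      (\<exists>d>x. \<forall>y z. x \<le> y \<longrightarrow> y < z \<longrightarrow> z \<le> d \<longrightarrow> f z < f y)"
    and lipschitz: "\<exists>K. K-lipschitz_on UNIV f"
begin

lemma affine:
  assumes "max_pos_slope \<alpha> f a b" "a \<le> x" "x \<le> b"
  shows "f x = f a + h / L * (x - a)"
proof -
  obtain s where s: "\<And>x y. x \<in> {a..b} \<Longrightarrow> y \<in> {a..b} \<Longrightarrow> f y - f x = s * (y - x)"
    using assms(1) unfolding max_pos_slope_def const_pos_slope_def by blast
  have "h = s * L" using s[of a b] length_rise[OF assms(1)] max_pos_slope_less[OF assms(1)] by simp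
  then have "s = h / L" using L_pos by simp
  then show ?thesis using s[of a x] assms by simp
qed

text \<open>Two abutting maximal intervals would have the common slope \<open>h / L\<close> and merge.\<close>

lemma not_abutting:
  assumes "max_pos_slope \<alpha> f a b" "max_pos_slope \<alpha> f b c"
  shows False
proof -
  note ab = max_pos_slope_less[OF assms(1)] and bc = max_pos_slope_less[OF assms(2)]
  have fx: "f x = f a + h / L * (x - a)" if "a \<le> x" "x \<le> c" for x
  proof (cases "x \<le> b")
    case True
    then show ?thesis using affine[OF assms(1) that(1)] by blast
  next
    case False
    then have "f x = f b + h / L * (x - b)" using affine[OF assms(2), of x] that by simp
    also have "f b = f a + h / L * (b - a)" using affine[OF assms(1), of b] ab by simp
    finally show ?thesis unfolding right_diff_distrib by linarith
  qed
  have "const_pos_slope f a c"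
    unfolding const_pos_slope_def
  proof (intro conjI exI[of _ "h / L"] ballI)
    fix x y assume "x \<in> {a..c}" "y \<in> {a..c}"
    then show "f y - f x = h / L * (y - x)"
      using fx[of x] fx[of y] unfolding right_diff_distrib by simp
  qed (use ab bc L_pos h_pos in auto)
  moreover have "{a..c} \<subseteq> {0..\<alpha>}"
    using max_pos_slope_bounds[OF assms(1)] max_pos_slope_bounds[OF assms(2)] by auto
  moreover have "{a..b} \<subseteq> {a..c}" using bc by auto
  ultimately have "{a..c} = {a..b}"
    using assms(1) unfolding max_pos_slope_def by blast
  then show False using ab bc by (simp add: Icc_eq_Icc)
qed

end

section \<open>Explicit form of one modification step\<close>

locale sawtooth_step = sawtooth +
  fixes e :: real
  assumes e: "0 < e" "e < L"
begin

text \<open>\<open>L'\<close> and \<open>h'\<close> are the length and the rise of each outer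
  segment of a zigzag. The middle segment has length \<open>e\<close> and drop
  \<open>e / (1 - \<alpha>)\<close>, whence \<open>2 * L' + e = L\<close> and
  \<open>2 * h' - e / (1 - \<alpha>) = h\<close>.\<close>

definition "L' = (L - e) / 2"
definition "h' = h / 2 + e / (2 * (1 - \<alpha>))"
abbreviation "g \<equiv> psi_step \<alpha> e f"

lemma L'_pos: "0 < L'" using e by (simp add: L'_def)
lemma h'_pos: "0 < h'" using e h_pos alpha by (simp add: h'_def add_pos_pos)

lemma step_outside:
  assumes "\<And>a b. max_pos_slope \<alpha> f a b \<Longrightarrow> x \<le> a \<or> b \<le> x"
  shows "g x = f x"
  using assms unfolding psi_step_def by fastforce

text \<open>Carries the description over to the closed interval: an end of a maximal interval is
  never interior to another one, so \<open>g\<close> agrees with \<open>f\<close> there, and so does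
  the zigzag.\<close>

lemma step_zigzag:
  assumes "max_pos_slope \<alpha> f a b" "a \<le> x" "x \<le> b"
  shows "g x = zigzag \<alpha> e f a b x"
proof (cases "a < x \<and> x < b")
  case True
  then show ?thesis using psi_step_inside[OF assms(1)] by simp
next
  case False
  then have x: "x = a \<or> x = b" using assms by auto
  have "g x = f x"
  proof (rule step_outside)
    fix c d assume "max_pos_slope \<alpha> f c d"
    then show "x \<le> c \<or> d \<le> x"
      using max_pos_slope_disjoint[OF assms(1)] max_pos_slope_less x assms by fastforce
  qed
  then show ?thesis using x zigzag_ends[of e b a \<alpha> f] e length_rise[OF assms(1)] by auto
qed

lemma step_ends:
  assumes "max_pos_slope \<alpha> f a b"
  shows "g a = f a" "g b = f b"
  using step_zigzag[OF assms] zigzag_ends[of e b a \<alpha> f] e length_rise[OF assms]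
    max_pos_slope_less[OF assms] by auto

lemma midpoint:
  assumes "max_pos_slope \<alpha> f a b"
  shows "f ((a + b) / 2) = f a + h / 2" "f b = f a + h"
proof -
  have b: "b = a + L" using length_rise[OF assms] by simp
  have "f ((a + b) / 2) = f a + h / L * ((a + b) / 2 - a)"
    by (rule affine[OF assms]) (use b L_pos in auto)
  also have "(a + b) / 2 - a = L / 2" using b by (simp add: field_simps)
  finally show "f ((a + b) / 2) = f a + h / 2" using L_pos by simp
  show "f b = f a + h" using length_rise[OF assms] by simp
qed

text \<open>As \<open>f\<close> is affine on the interval, its midpoint value is
  \<open>f a + h / 2\<close>; the two breakpoints are therefore the ends of the graph shifted
  inwards by \<open>L'\<close> and vertically by \<open>h'\<close>.\<close>

lemma zigzag_pieces:
  assumes "max_pos_slope \<alpha> f a b"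
  shows "zigzag \<alpha> e f a b =
    (\<lambda>x. if x \<le> a + L' then line_through (a, f a) (a + L', f a + h') x
      else if x \<le> b - L' then line_through (a + L', f a + h') (b - L', f b - h') x
      else line_through (b - L', f b - h') (b, f b) x)"
proof -
  have b: "b = a + L" using length_rise[OF assms] by simp
  have "(a + b - e) / 2 = a + L'" "(a + b + e) / 2 = b - L'"
    by (simp_all add: b L'_def field_simps)
  moreover have "f ((a + b) / 2) + e / (2 * (1 - \<alpha>)) = f a + h'"
    "f ((a + b) / 2) - e / (2 * (1 - \<alpha>)) = f b - h'"
    using midpoint[OF assms] by (simp_all add: h'_def)
  ultimately show ?thesis unfolding zigzag_def Let_def fst_conv snd_conv by (simp only:)
qed

lemma breakpoints:
  assumes "max_pos_slope \<alpha> f a b"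
  shows "b - L' = a + L' + e" "f b - h' = f a + h' - e / (1 - \<alpha>)"
proof -
  have b: "b = a + L" using length_rise[OF assms] by simp
  show "b - L' = a + L' + e" by (simp add: b L'_def field_simps)
  have "2 * h' = h + e / (1 - \<alpha>)" using alpha by (simp add: h'_def field_simps)
  then show "f b - h' = f a + h' - e / (1 - \<alpha>)" using midpoint(2)[OF assms] by simp
qed

lemma step_left:
  assumes "max_pos_slope \<alpha> f a b" "a \<le> x" "x \<le> a + L'"
  shows "g x = f a + h' / L' * (x - a)"
proof -
  have "g x = zigzag \<alpha> e f a b x"
    using step_zigzag[OF assms(1,2)] assms(3) breakpoints(1)[OF assms(1)] e L'_pos by simp
  then show ?thesis using assms(3) by (simp add: zigzag_pieces[OF assms(1)] line_through_def)
qed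

lemma step_middle:
  assumes "max_pos_slope \<alpha> f a b" "a + L' \<le> x" "x \<le> b - L'"
  shows "g x = f a + h' - (x - (a + L')) / (1 - \<alpha>)"
\<comment> \<open>The \<open>if\<close> tests assign each joint to the segment on its left, so the
  value there comes from the preceding piece.\<close>
proof (cases "x = a + L'")
  case True
  then show ?thesis using step_left[OF assms(1), of x] L'_pos by simp
next
  case False
  have "g x = zigzag \<alpha> e f a b x"
    using step_zigzag[OF assms(1)] assms(2,3) L'_pos by simp
  also have "\<dots> = line_through (a + L', f a + h') (b - L', f b - h') x"
    using False assms(2,3) by (simp add: zigzag_pieces[OF assms(1)])
  also have "\<dots> = f a + h' - (x - (a + L')) / (1 - \<alpha>)"
    unfolding line_through_def breakpoints[OF assms(1)] using e alpha by simp
  finally show ?thesis .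
qed

lemma step_right:
  assumes "max_pos_slope \<alpha> f a b" "b - L' \<le> x" "x \<le> b"
  shows "g x = f b - h' + h' / L' * (x - (b - L'))"
proof (cases "x = b - L'")
  case True
  have "g x = f a + h' - (x - (a + L')) / (1 - \<alpha>)"
    by (rule step_middle[OF assms(1)]) (use True breakpoints[OF assms(1)] e in auto)
  then show ?thesis using True breakpoints[OF assms(1)] by simp
next
  case False
  have "g x = zigzag \<alpha> e f a b x"
    using step_zigzag[OF assms(1)] assms(2,3) breakpoints(1)[OF assms(1)] e L'_pos by simp
  then show ?thesis
    using False assms(2) breakpoints(1)[OF assms(1)] e
    by (simp add: zigzag_pieces[OF assms(1)] line_through_def)
qed

section \<open>Intervals of constant positive slope after the step\<close>

lemma step_middle_decreasing:
  assumes "max_pos_slope \<alpha> f a b" "a + L' \<le> y" "y < z" "z \<le> b - L'"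
  shows "g z < g y"
  using assms alpha by (simp add: step_middle[OF assms(1)] divide_strict_right_mono)

lemma const_pos_slope_halves:
  assumes "max_pos_slope \<alpha> f a b"
  shows "const_pos_slope g a (a + L')" "const_pos_slope g (b - L') b"
proof -
  have s: "h' / L' > 0" using h'_pos L'_pos by simp
  show "const_pos_slope g a (a + L')"
    unfolding const_pos_slope_def
  proof (intro conjI exI[of _ "h' / L'"] ballI)
    fix x y assume "x \<in> {a..a + L'}" "y \<in> {a..a + L'}"
    then show "g y - g x = h' / L' * (y - x)"
      by (simp add: step_left[OF assms] right_diff_distrib)
  qed (use s L'_pos in auto)
  show "const_pos_slope g (b - L') b"
    unfolding const_pos_slope_def
  proof (intro conjI exI[of _ "h' / L'"] ballI)
    fix x y assume "x \<in> {b - L'..b}" "y \<in> {b - L'..b}"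
    then show "g y - g x = h' / L' * (y - x)"
      by (simp add: step_right[OF assms] right_diff_distrib)
  qed (use s L'_pos in auto)
qed

text \<open>A maximal interval with \<open>y\<close> in its interior would make \<open>f\<close>
  increase from \<open>y\<close> to \<open>min b d\<close>, where it is assumed to decrease; so the
  step does not touch \<open>y\<close>.\<close>

lemma step_eq_if_decreasing:
  assumes "\<forall>y z. x \<le> y \<longrightarrow> y < z \<longrightarrow> z \<le> d \<longrightarrow> f z < f y" "x \<le> y" "y < d"
    and "\<not> (\<exists>a b. max_pos_slope \<alpha> f a b \<and> a \<le> x \<and> x < b)"
  shows "g y = f y"
proof (rule step_outside, rule ccontr)
  fix a b assume ab: "max_pos_slope \<alpha> f a b" and "\<not> (y \<le> a \<or> b \<le> y)"
  then have y: "a < y" "y < b" by auto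
  then have "f y < f (min b d)"
    using ab assms(3) unfolding max_pos_slope_def
    by (intro const_pos_slope_incseq[of f a b]) auto
  moreover have "f (min b d) < f y"
    using assms(1)[rule_format, of y "min b d"] assms(2,3) y by auto
  ultimately show False by simp
qed

text \<open>Carries \<open>right_germ\<close> from \<open>f\<close> over to \<open>g\<close>: a
  replaced interval splits into two rising halves and a falling middle, and a falling germ of
  \<open>f\<close> outside the intervals survives. It serves both to locate the rising intervals of
  \<open>g\<close> and to re-establish \<open>right_germ\<close>.\<close>

lemma step_germ_cases:
  assumes "0 \<le> x" "x < \<alpha>"
  obtains (left) a b where "max_pos_slope \<alpha> f a b" "a \<le> x" "x < a + L'"
  | (right) a b where "max_pos_slope \<alpha> f a b" "b - L' \<le> x" "x < b"
  | (down) d where "d > x" "\<forall>y z. x \<le> y \<longrightarrow> y < z \<longrightarrow> z \<le> d \<longrightarrow> g z < g y"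
proof (cases "\<exists>a b. max_pos_slope \<alpha> f a b \<and> a \<le> x \<and> x < b")
  case True
  then obtain a b where ab: "max_pos_slope \<alpha> f a b" "a \<le> x" "x < b" by blast
  consider "x < a + L'" | "a + L' \<le> x" "x < b - L'" | "b - L' \<le> x" by linarith
  then show ?thesis
  proof cases
    case 2
    then show ?thesis using step_middle_decreasing[OF ab(1)] down[of "b - L'"] by auto
  qed (use ab left right in blast)+
next
  case False
  then obtain d where d: "d > x" "\<forall>y z. x \<le> y \<longrightarrow> y < z \<longrightarrow> z \<le> d \<longrightarrow> f z < f y"
    using right_germ[OF assms] by blast
  have eq: "g y = f y" if "x \<le> y" "y < d" for y
    using step_eq_if_decreasing[OF d(2) that False] .
  \<comment> \<open>The halfway point stays strictly below \<open>d\<close>, as \<open>g\<close> and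
    \<open>f\<close> are known to agree only to the left of \<open>d\<close>.\<close>
  show ?thesis
    by (rule down[of "(x + d) / 2"]) (use d eq in auto)
qed

text \<open>The germ of \<open>g\<close> at \<open>c\<close> cannot fall, so \<open>c\<close> lies
  in a half. From a left half \<open>d\<close> cannot move past \<open>a + L'\<close>, where the
  falling middle begins; from a right half it cannot move past \<open>b\<close>, because the germ at
  \<open>b\<close> must fall.\<close>

lemma const_pos_slope_step:
  assumes cd: "const_pos_slope g c d" "{c..d} \<subseteq> {0..\<alpha>}"
  obtains a b where "max_pos_slope \<alpha> f a b"
    "{c..d} \<subseteq> {a..a + L'} \<or> {c..d} \<subseteq> {b - L'..b}"
proof -
  have "c < d" using cd by (simp add: const_pos_slope_def)
  then have c: "0 \<le> c" "d \<le> \<alpha>" using cd(2) by auto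
  have no_down: False
    if "c \<le> x" "x < d" "x < u" "\<forall>y z. x \<le> y \<longrightarrow> y < z \<longrightarrow> z \<le> u \<longrightarrow> g z < g y" for x u
    using const_pos_slope_incseq[OF cd(1), of x "min u d"]
      that(4)[rule_format, of x "min u d"] that(1-3) by auto
  have "0 \<le> c" "c < \<alpha>" using c \<open>c < d\<close> by auto
  then show ?thesis
  proof (cases rule: step_germ_cases)
    case (left a b)
    have "d \<le> a + L'"
    proof (rule ccontr)
      assume "\<not> ?thesis"
      then show False
        using no_down[of "a + L'" "b - L'"] step_middle_decreasing[OF left(1)] left
          breakpoints(1)[OF left(1)] e by auto
    qed
    then show ?thesis using that[OF left(1)] left by auto
  next
    case (right a b)
    have "d \<le> b"
    proof (rule ccontr)
      assume neg: "\<not> ?thesis"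
      note ab = max_pos_slope_less[OF right(1)] max_pos_slope_bounds[OF right(1)]
      \<comment> \<open>By disjointness an interval containing \<open>b\<close> and reaching beyond
        it would start at \<open>b\<close>, and abutting maximal intervals are excluded. Only the
        falling germ remains at \<open>b\<close>.\<close>
      have no: False if ij: "max_pos_slope \<alpha> f i j" "i \<le> b" "b < j" for i j
      proof -
        have "i = b" using max_pos_slope_disjoint[OF right(1) ij(1)] ij ab by auto
        then show False using not_abutting right(1) ij(1) by blast
      qed
      have "0 \<le> b" "b < \<alpha>" using neg c ab by auto
      then show False
      proof (cases rule: step_germ_cases)
        case (left i j)
        then show False using no[OF left(1)] breakpoints(1)[OF left(1)] e L'_pos by simp
      next
        case R: (right i j)
        then show False using no[OF R(1)] breakpoints(1)[OF R(1)] e L'_pos by simp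
      next
        case (down u)
        then show False using no_down[of b u] right neg by auto
      qed
    qed
    then show ?thesis using that[OF right(1)] right by auto
  next
    case (down u)
    then show ?thesis using no_down[of c u] \<open>c < d\<close> by auto
  qed
qed

text \<open>
  A half can only be enlarged inside another half, which has the same length; hence it is maximal.
\<close>

lemma max_pos_slope_halves:
  assumes ab: "max_pos_slope \<alpha> f a b"
  shows "max_pos_slope \<alpha> g a (a + L')" "max_pos_slope \<alpha> g (b - L') b"
proof -
  have enlarge: "{c..d} = {u..u + L'}"
    if "{c..d} \<subseteq> {0..\<alpha>} \<and> const_pos_slope g c d \<and> {u..u + L'} \<subseteq> {c..d}" for u c d
  proof -
    have "const_pos_slope g c d" "{c..d} \<subseteq> {0..\<alpha>}" using that by auto
    then obtain i j where "{c..d} \<subseteq> {i..i + L'} \<or> {c..d} \<subseteq> {j - L'..j}"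
      by (rule const_pos_slope_step)
    then have "{c..d} \<subseteq> {i..i + L'} \<or> {c..d} \<subseteq> {(j - L')..(j - L') + L'}" by simp
    then obtain v where v: "{c..d} \<subseteq> {v..v + L'}" by blast
    have "{u..u + L'} \<subseteq> {v..v + L'}" using that v by blast
    then have "u = v" using L'_pos by auto
    then show ?thesis using that v by blast
  qed
  have bounds: "{a..a + L'} \<subseteq> {0..\<alpha>}" "{b - L'..b} \<subseteq> {0..\<alpha>}"
    using max_pos_slope_bounds[OF ab] breakpoints(1)[OF ab] e L'_pos by auto
  show "max_pos_slope \<alpha> g a (a + L')"
    unfolding max_pos_slope_def using bounds const_pos_slope_halves[OF ab] enlarge by blast
  have "b - L' + L' = b" by simp
  note right = enlarge[of _ _ "b - L'", unfolded this]
  show "max_pos_slope \<alpha> g (b - L') b"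
    unfolding max_pos_slope_def using bounds const_pos_slope_halves[OF ab] right by blast
qed

text \<open>The interval lies in a half, and its own maximality makes it equal to that half.
  Together with \<open>max_pos_slope_halves\<close> this determines all maximal intervals of
  \<open>g\<close>, hence their common length and rise.\<close>

lemma max_pos_slope_stepE:
  assumes "max_pos_slope \<alpha> g c d"
  obtains a b where "max_pos_slope \<alpha> f a b" "c = a \<and> d = a + L' \<or> c = b - L' \<and> d = b"
proof -
  have cd: "const_pos_slope g c d" "{c..d} \<subseteq> {0..\<alpha>}" "c < d"
    using assms by (auto simp: max_pos_slope_def const_pos_slope_def)
  have max: "{u..v} = {c..d}" if "max_pos_slope \<alpha> g u v" "{c..d} \<subseteq> {u..v}" for u v
    using assms that unfolding max_pos_slope_def by blast
  obtain a b where ab: "max_pos_slope \<alpha> f a b"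
    "{c..d} \<subseteq> {a..a + L'} \<or> {c..d} \<subseteq> {b - L'..b}"
    using const_pos_slope_step[OF cd(1,2)] .
  then have "{a..a + L'} = {c..d} \<or> {b - L'..b} = {c..d}"
    using max max_pos_slope_halves[OF ab(1)] by blast
  then show ?thesis using that[OF ab(1)] \<open>c < d\<close> by (auto simp: Icc_eq_Icc)
qed

section \<open>Lipschitz continuity after the step\<close>

lemma step_lipschitz_piece:
  assumes "max_pos_slope \<alpha> f a b"
  shows "(max (h' / L') (1 / (1 - \<alpha>)))-lipschitz_on {a..b} g"
proof -
  let ?K = "max (h' / L') (1 / (1 - \<alpha>))"
  have neg: "f b - h' - (f a + h') = - (e / (1 - \<alpha>))" "b - L' - (a + L') = e"
    using breakpoints[OF assms] by auto
  have outer: "\<bar>h' / L'\<bar> \<le> ?K" and inner: "\<bar>- (e / (1 - \<alpha>)) / e\<bar> \<le> ?K"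
    using h'_pos L'_pos alpha e by auto
  have l1: "?K-lipschitz_on {a..a + L'} (line_through (a, f a) (a + L', f a + h'))"
    by (rule lipschitz_on_le[OF line_through_lipschitz]) (use outer in simp)
  have l2: "?K-lipschitz_on {a + L'..b - L'} (line_through (a + L', f a + h') (b - L', f b - h'))"
    by (rule lipschitz_on_le[OF line_through_lipschitz])
      (use inner in \<open>simp only: fst_conv snd_conv neg\<close>)
  have l3: "?K-lipschitz_on {b - L'..b} (line_through (b - L', f b - h') (b, f b))"
    by (rule lipschitz_on_le[OF line_through_lipschitz]) (use outer in simp)
  have "?K-lipschitz_on {a..b} (zigzag \<alpha> e f a b)"
    unfolding zigzag_pieces[OF assms]
    by (rule lipschitz_on_concat[OF l1 lipschitz_on_concat[OF l2 l3]])
      (use L'_pos breakpoints(1)[OF assms] e in \<open>auto simp: line_through_def\<close>)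
  then show ?thesis
    by (rule lipschitz_on_transform) (simp add: step_zigzag[OF assms])
qed

text \<open>The local estimates are glued without counting the intervals. Unless one interval
  contains both points \<open>x < y\<close>, each point is moved towards the other up to the end of
  its interval, where \<open>g\<close> equals \<open>f\<close>. The three distances add up to
  \<open>y - x\<close>, so the constant \<open>K\<close> is kept.\<close>

lemma step_lipschitz: "\<exists>K. K-lipschitz_on UNIV g"
proof -
  obtain K0 where K0: "K0-lipschitz_on UNIV f" using lipschitz by blast
  define K where "K = max K0 (max (h' / L') (1 / (1 - \<alpha>)))"
  have piece: "\<bar>g x - g y\<bar> \<le> K * \<bar>x - y\<bar>"
    if "max_pos_slope \<alpha> f a b" "a \<le> x" "x \<le> b" "a \<le> y" "y \<le> b" for a b x y
    using lipschitz_onD[OF lipschitz_on_le[OF step_lipschitz_piece[OF that(1)]], of K x y] that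
    by (auto simp: K_def dist_real_def)
  have base: "\<bar>f x - f y\<bar> \<le> K * \<bar>x - y\<bar>" for x y
    using lipschitz_onD[OF lipschitz_on_le[OF K0], of K x y]
    by (auto simp: K_def dist_real_def)
  have le: "\<bar>g x - g y\<bar> \<le> K * (y - x)" if "x < y" for x y
  proof (cases "\<exists>a b. max_pos_slope \<alpha> f a b \<and> a \<le> x \<and> y \<le> b")
    case True
    then obtain a b where ab: "max_pos_slope \<alpha> f a b" "a \<le> x" "y \<le> b" by blast
    show ?thesis using piece[OF ab(1), of x y] ab that by simp
  next
    case False
    \<comment> \<open>\<open>u\<close> is the right end of the interval around \<open>x\<close>, or
      \<open>x\<close> itself if \<open>x\<close> is interior to none; \<open>v\<close> below is the
      mirror image for \<open>y\<close>.\<close>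
    obtain u where u: "x \<le> u" "g u = f u" "\<bar>g x - g u\<bar> \<le> K * \<bar>x - u\<bar>"
      "u = x \<or> (\<exists>a. max_pos_slope \<alpha> f a u \<and> a < x \<and> x < u)"
    proof (cases "\<exists>a b. max_pos_slope \<alpha> f a b \<and> a < x \<and> x < b")
      case True
      then obtain a b where ab: "max_pos_slope \<alpha> f a b" "a < x" "x < b" by blast
      then show ?thesis using that[of b] piece[OF ab(1), of x b] step_ends[OF ab(1)] by auto
    next
      case False
      then have "g x = f x" by (intro step_outside) force
      then show ?thesis using that[of x] by simp
    qed
    obtain v where v: "v \<le> y" "g v = f v" "\<bar>g v - g y\<bar> \<le> K * \<bar>v - y\<bar>"
      "v = y \<or> (\<exists>b. max_pos_slope \<alpha> f v b \<and> v < y \<and> y < b)"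
    proof (cases "\<exists>a b. max_pos_slope \<alpha> f a b \<and> a < y \<and> y < b")
      case True
      then obtain a b where ab: "max_pos_slope \<alpha> f a b" "a < y" "y < b" by blast
      then show ?thesis using that[of a] piece[OF ab(1), of a y] step_ends[OF ab(1)] by auto
    next
      case False
      then have "g y = f y" by (intro step_outside) force
      then show ?thesis using that[of y] by simp
    qed
    \<comment> \<open>If \<open>u\<close> exceeded \<open>v\<close>, a single maximal interval would
      contain both \<open>x\<close> and \<open>y\<close>; when two intervals are involved, their
      overlap makes them equal.\<close>
    have "u \<le> v"
    proof (rule ccontr)
      assume neg: "\<not> u \<le> v"
      consider "u = x" "v = y" | a where "max_pos_slope \<alpha> f a u" "a < x" "x < u" "v = y"
        | b where "max_pos_slope \<alpha> f v b" "v < y" "y < b" "u = x"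
        | a b where "max_pos_slope \<alpha> f a u" "max_pos_slope \<alpha> f v b" "a < x" "x < u" "v < y" "y < b"
        using u(4) v(4) by blast
      then show False
      proof cases
        case 1
        then show False using neg that by simp
      next
        case (2 a)
        then have "a \<le> x" "y \<le> u" using neg by auto
        then show False using False 2(1) by blast
      next
        case (3 b)
        then have "v \<le> x" "y \<le> b" using neg by auto
        then show False using False 3(1) by blast
      next
        case (4 a b)
        then have "u = b" using max_pos_slope_disjoint[OF 4(1,2)] neg that by auto
        then have "a \<le> x" "y \<le> u" using 4 by auto
        then show False using False 4(1) by blast
      qed
    qed
    have "\<bar>g x - g y\<bar> \<le> \<bar>g x - g u\<bar> + \<bar>f u - f v\<bar> + \<bar>g v - g y\<bar>"
      using u(2) v(2) by linarith
    also have "\<dots> \<le> K * \<bar>x - u\<bar> + K * \<bar>u - v\<bar> + K * \<bar>v - y\<bar>"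
      using u(3) v(3) base[of u v] by linarith
    also have "\<dots> = K * (y - x)"
      using u(1) v(1) \<open>u \<le> v\<close> by (simp add: algebra_simps)
    finally show ?thesis .
  qed
  have "K-lipschitz_on UNIV g"
  proof (rule lipschitz_onI)
    fix x y show "dist (g x) (g y) \<le> K * dist x y"
      using le[of x y] le[of y x]
      by (cases x y rule: linorder_cases) (auto simp: dist_real_def abs_minus_commute)
    show "0 \<le> K" using lipschitz_on_nonneg[OF K0] by (simp add: K_def)
  qed
  then show ?thesis ..
qed

section \<open>Size of the modification and persistence of the invariant\<close>

lemma step_dist_le: "\<bar>g x - f x\<bar> \<le> 2 * h'"
proof (cases "\<exists>a b. max_pos_slope \<alpha> f a b \<and> a < x \<and> x < b")
  case False
  then have "g x = f x" by (intro step_outside) force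
  then show ?thesis using h'_pos by simp
next
  case True
  then obtain a b where ab: "max_pos_slope \<alpha> f a b" "a < x" "x < b" by blast
  \<comment> \<open>\<open>m\<close> is the value of \<open>f\<close> at the midpoint of the
    interval. All four vertices of the zigzag have heights within \<open>h'\<close> of it, and
    \<open>f x\<close> lies between the end values, so both \<open>f x\<close> and
    \<open>g x\<close> are within \<open>h'\<close> of \<open>m\<close>.\<close>
  define m where "m = f a + h / 2"
  have m: "\<bar>f a - m\<bar> \<le> h'" "\<bar>f a + h' - m\<bar> \<le> h'" "\<bar>f b - h' - m\<bar> \<le> h'" "\<bar>f b - m\<bar> \<le> h'"
    using midpoint(2)[OF ab(1)] h_pos e alpha by (auto simp: m_def h'_def)
  have "f a < f x" "f x < f b"
    using ab unfolding max_pos_slope_def by (auto intro: const_pos_slope_incseq)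
  then have "\<bar>f x - m\<bar> \<le> h'" using m by linarith
  moreover have "\<bar>g x - m\<bar> \<le> h'"
  proof -
    have "g x = zigzag \<alpha> e f a b x" using step_zigzag[OF ab(1)] ab by simp
    then show ?thesis
      using ab m L'_pos breakpoints(1)[OF ab(1)] e
      unfolding zigzag_pieces[OF ab(1)] by (auto intro!: line_through_dist_le simp del: abs_le_iff)
  qed
  ultimately show ?thesis by linarith
qed

lemma step_sawtooth: "sawtooth \<alpha> g L' h'"
proof
  fix c d assume "max_pos_slope \<alpha> g c d"
  then obtain a b where ab: "max_pos_slope \<alpha> f a b" "c = a \<and> d = a + L' \<or> c = b - L' \<and> d = b"
    by (rule max_pos_slope_stepE)
  then show "d - c = L' \<and> g d - g c = h'"
    using step_left[OF ab(1), of a] step_left[OF ab(1), of "a + L'"]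
      step_right[OF ab(1), of b] step_right[OF ab(1), of "b - L'"] L'_pos by auto
next
  fix x assume "0 \<le> x" "x < \<alpha>"
  then show "(\<exists>a b. max_pos_slope \<alpha> g a b \<and> a \<le> x \<and> x < b) \<or>
      (\<exists>d>x. \<forall>y z. x \<le> y \<longrightarrow> y < z \<longrightarrow> z \<le> d \<longrightarrow> g z < g y)"
    by (cases rule: step_germ_cases) (use max_pos_slope_halves in blast)+
qed (use alpha L'_pos h'_pos step_lipschitz in auto)

end

section \<open>The starting function\<close>

lemma sawtooth_psi_seq_0:
  assumes "0 < \<alpha>" "\<alpha> < 1"
  shows "sawtooth \<alpha> (psi_seq \<alpha> \<epsilon> 0) \<alpha> 1"
proof -
  let ?f = "psi_seq \<alpha> \<epsilon> 0"
  have cps: "const_pos_slope ?f 0 \<alpha>"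
    unfolding const_pos_slope_def using assms
    by (auto intro!: exI[of _ "1 / \<alpha>"] simp: diff_divide_distrib)
  then have max: "max_pos_slope \<alpha> ?f 0 \<alpha>"
    unfolding max_pos_slope_def by blast
  \<comment> \<open>The interval from 0 to \<alpha> fills the whole admissible range, so
    disjointness leaves room for no other.\<close>
  have uniq: "a = 0 \<and> b = \<alpha>" if "max_pos_slope \<alpha> ?f a b" for a b
    using max_pos_slope_disjoint[OF max that] max_pos_slope_bounds[OF that]
      max_pos_slope_less[OF that] by auto
  define K where "K = max (1 / \<alpha>) (1 / (1 - \<alpha>))"
  have K: "1 / \<alpha> \<le> K" "1 / (1 - \<alpha>) \<le> K" "0 \<le> K" using assms by (auto simp: K_def le_max_iff_disj)
  have left: "\<bar>x / \<alpha> - y / \<alpha>\<bar> \<le> K * \<bar>x - y\<bar>" for x y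
    using mult_right_mono[OF K(1), of "\<bar>x - y\<bar>"] assms by (simp add: diff_divide_distrib[symmetric])
  have right: "\<bar>(1 - x) / (1 - \<alpha>) - (1 - y) / (1 - \<alpha>)\<bar> \<le> K * \<bar>x - y\<bar>" for x y
    using mult_right_mono[OF K(2), of "\<bar>x - y\<bar>"] assms
    by (simp add: diff_divide_distrib[symmetric] abs_minus_commute)
  \<comment> \<open>For points on different sides of the peak the estimate passes through \<alpha>,
    where both formulas have the value 1.\<close>
  have mixed: "\<bar>x / \<alpha> - (1 - y) / (1 - \<alpha>)\<bar> \<le> K * (y - x)" if "x \<le> \<alpha>" "\<alpha> < y" for x y
  proof -
    have "\<bar>x / \<alpha> - (1 - y) / (1 - \<alpha>)\<bar>
      \<le> \<bar>x / \<alpha> - \<alpha> / \<alpha>\<bar> + \<bar>(1 - \<alpha>) / (1 - \<alpha>) - (1 - y) / (1 - \<alpha>)\<bar>"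
      using assms by simp
    also have "\<dots> \<le> K * \<bar>x - \<alpha>\<bar> + K * \<bar>\<alpha> - y\<bar>"
      by (intro add_mono left right)
    also have "\<dots> = K * (y - x)" using that by (simp add: algebra_simps)
    finally show ?thesis .
  qed
  have "K-lipschitz_on UNIV ?f"
  proof (rule lipschitz_onI)
    fix x y show "dist (?f x) (?f y) \<le> K * dist x y"
      using left[of x y] right[of x y] mixed[of x y] mixed[of y x]
      by (auto simp: dist_real_def abs_minus_commute)
  qed (rule K)
  then have "\<exists>K. K-lipschitz_on UNIV ?f" ..
  then show ?thesis
  proof unfold_locales
    show "b - a = \<alpha> \<and> ?f b - ?f a = 1" if "max_pos_slope \<alpha> ?f a b" for a b
      using uniq[OF that] assms by simp
    show "(\<exists>a b. max_pos_slope \<alpha> ?f a b \<and> a \<le> x \<and> x < b) \<or>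
        (\<exists>d>x. \<forall>y z. x \<le> y \<longrightarrow> y < z \<longrightarrow> z \<le> d \<longrightarrow> ?f z < ?f y)"
      if "0 \<le> x" "x < \<alpha>" for x
      using max that by blast
  qed (use assms in auto)
qed

section \<open>Uniform convergence and continuity of the limit\<close>

theorem corollary5p3:
  fixes \<alpha> :: real and \<epsilon> :: "nat \<Rightarrow> real"
  assumes "0 < \<alpha>" and "\<alpha> < 1"
    and "\<And>i. i \<ge> 1 \<Longrightarrow> \<epsilon> i > 0"
    and "\<And>i j. 1 \<le> i \<Longrightarrow> i \<le> j \<Longrightarrow> \<epsilon> j \<le> \<epsilon> i"
    and "\<epsilon> 1 \<le> 1 - \<alpha>"
    and "summable (\<lambda>i. 2 ^ i * \<epsilon> (Suc i))"
    and "(\<Sum>i. 2 ^ i * \<epsilon> (Suc i)) < \<alpha>"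
  shows "continuous_on {0..<1} (psi \<alpha> \<epsilon>)"
proof -
  \<comment> \<open>\<open>L\<close> and \<open>h\<close> are the closed forms of the recursions for
    \<open>L'\<close> and \<open>h'\<close>, with initial values \<alpha> and 1; \<open>S n\<close>
    collects the weighted \<epsilon> used in the first \<open>n\<close> steps.\<close>
  define S where "S n = (\<Sum>i<n. 2 ^ i * \<epsilon> (Suc i))" for n
  define L where "L n = (\<alpha> - S n) / 2 ^ n" for n
  define h where "h n = (1 + S n / (1 - \<alpha>)) / 2 ^ n" for n
  let ?f = "psi_seq \<alpha> \<epsilon>"
  have S_lt: "S n < \<alpha>" for n
    using sum_le_suminf[OF assms(6), of "{..<n}"] assms(3,7) by (fastforce simp: S_def less_imp_le)
  have S_Suc: "S (Suc n) = S n + 2 ^ n * \<epsilon> (Suc n)" for n by (simp add: S_def)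
  have L_Suc: "L (Suc n) = (L n - \<epsilon> (Suc n)) / 2" for n
    by (simp add: L_def S_Suc field_simps)
  have h_Suc: "h (Suc n) = h n / 2 + \<epsilon> (Suc n) / (2 * (1 - \<alpha>))" for n
    using assms(2) by (simp add: h_def S_Suc divide_simps) (simp add: algebra_simps)
  \<comment> \<open>The zigzag fits into the interval exactly when the next length is positive,
    which the bound on the partial sums ensures.\<close>
  have eps_lt: "\<epsilon> (Suc n) < L n" for n
  proof -
    have "0 < L (Suc n)" using S_lt[of "Suc n"] by (simp add: L_def)
    then show ?thesis by (simp add: L_Suc)
  qed
  have step: "sawtooth_step \<alpha> (?f n) (L n) (h n) (\<epsilon> (Suc n))" if "sawtooth \<alpha> (?f n) (L n) (h n)" for n
    using that assms(3) eps_lt by (intro sawtooth_step.intro sawtooth_step_axioms.intro) auto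
  have saw: "sawtooth \<alpha> (?f n) (L n) (h n)" for n
  proof (induction n)
    case 0
    then show ?case
      using sawtooth_psi_seq_0[OF assms(1,2)] by (simp add: L_def h_def S_def del: psi_seq.simps)
  next
    case (Suc n)
    interpret sawtooth_step \<alpha> "?f n" "L n" "h n" "\<epsilon> (Suc n)" by (rule step[OF Suc])
    show ?case using step_sawtooth by (simp add: L'_def h'_def L_Suc h_Suc)
  qed
  have dist: "norm (?f (Suc n) x - ?f n x) \<le> (1 / (1 - \<alpha>)) * (1 / 2) ^ n" for n x
  proof -
    interpret sawtooth_step \<alpha> "?f n" "L n" "h n" "\<epsilon> (Suc n)" by (rule step[OF saw])
    have "norm (?f (Suc n) x - ?f n x) \<le> 2 * h (Suc n)"
      using step_dist_le by (simp add: h'_def h_Suc)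
    also have "\<dots> = (1 + S (Suc n) / (1 - \<alpha>)) / 2 ^ n"
      by (simp add: h_def del: distrib_left_numeral)
    \<comment> \<open>\<open>S (Suc n) < \<alpha>\<close> gives the bound because
      \<open>1 + \<alpha> / (1 - \<alpha>) = 1 / (1 - \<alpha>)\<close>.\<close>
    also have "\<dots> \<le> (1 / (1 - \<alpha>)) / 2 ^ n"
      using S_lt[of "Suc n"] assms(2) by (intro divide_right_mono) (auto simp: divide_simps)
    finally show ?thesis by (simp add: power_one_over)
  qed
  \<comment> \<open>The M-test applies to the series of increments, which telescopes; adding the
    starting function turns its partial sums back into the sequence itself.\<close>
  have "uniform_limit UNIV (\<lambda>n x. \<Sum>i<n. ?f (Suc i) x - ?f i x)
      (\<lambda>x. \<Sum>i. ?f (Suc i) x - ?f i x) sequentially"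
    by (rule Weierstrass_m_test[OF dist]) (auto intro!: summable_mult summable_geometric)
  then have "uniform_limit UNIV (\<lambda>n x. (\<Sum>i<n. ?f (Suc i) x - ?f i x) + ?f 0 x)
      (\<lambda>x. (\<Sum>i. ?f (Suc i) x - ?f i x) + ?f 0 x) sequentially"
    by (intro uniform_limit_intros)
  moreover have "(\<Sum>i<n. ?f (Suc i) x - ?f i x) + ?f 0 x = ?f n x" for n x
    using sum_lessThan_telescope[of "\<lambda>i. ?f i x" n] by (simp del: psi_seq.simps)
  ultimately have lim: "uniform_limit UNIV ?f (\<lambda>x. (\<Sum>i. ?f (Suc i) x - ?f i x) + ?f 0 x) sequentially"
    by (simp only:)
  have "continuous_on UNIV (?f n)" for n
    using sawtooth.lipschitz[OF saw] lipschitz_on_continuous_on by blast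
  then have "continuous_on UNIV (\<lambda>x. (\<Sum>i. ?f (Suc i) x - ?f i x) + ?f 0 x)"
    by (intro uniform_limit_theorem[OF _ lim]) auto
  \<comment> \<open>The operator \<open>lim\<close> in \<open>psi\<close> yields the intended value
    since uniform convergence implies convergence at each point.\<close>
  moreover have "psi \<alpha> \<epsilon> = (\<lambda>x. (\<Sum>i. ?f (Suc i) x - ?f i x) + ?f 0 x)"
    unfolding psi_def using tendsto_uniform_limitI[OF lim] by (intro ext limI) simp
  ultimately show ?thesis by (metis continuous_on_subset subset_UNIV)
qed

end
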